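(* Let $\mathcal{E}$ be a Hilbert space and let $\mathcal{H}_k\otimes\mathcal{E}$ be the $\mathcal{E}$-valued Hardy space, or the $\mathcal{E}$-valued Bergman space, or the $\mathcal{E}$-valued Dirichlet space, on the polydisc $\mathbb{D}^n$. Then for any contractive multiplier $\Phi\in\mathrm{Mult}(\mathcal{H}_k\otimes\mathcal{E})$ the following statements are equivalent: (i) $M_\Phi$ is a pure contraction on $\mathcal{H}_k\otimes\mathcal{E}$; (ii) $\Phi(0)$ is a pure contraction on $\mathcal{E}$.
   Context: A contraction $T$ on a Hilbert space $\mathcal{H}$ is pure if $\|T^{*m}h\|\to0$ as $m\to\infty$ for every $h\in\mathcal{H}$. For a scalar kernel $k$ on $\mathbb{D}^n$, $\mathcal{H}_k\otimes\mathcal{E}$ is the reproducing kernel Hilbert space of $\mathcal{E}$-valued functions on $\mathbb{D}^n$ with kernel $k(\mathbf{z},\mathbf{w})I_{\mathcal{E}}$. The kernels are: Hardy, $k(\mathbf{z},\mathbf{w})=\prod_{i=1}^n(1-z_i\bar w_i)^{-1}$; Bergman, $k(\mathbf{z},\mathbf{w})=\prod_{i=1}^n(1-z_i\bar w_i)^{-2}$; Dirichlet, $k(\mathbf{z},\mathbf{w})=\prod_{i=1}^n\left(-\frac{1}{z_i\bar w_i}\ln(1-z_i\bar w_i)\right)$ (each factor being interpreted as $1$ when $z_i\bar w_i=0$). $\mathrm{Mult}(\mathcal{H}_k\otimes\mathcal{E})$ is the set of functions $\Phi:\mathbb{D}^n\to\mathcal{B}(\mathcal{E})$ such that $\Phi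 f\in\mathcal{H}_k\otimes\mathcal{E}$ for all $f\in\mathcal{H}_k\otimes\mathcal{E}$, where $(\Phi f)(\mathbf z)=\Phi(\mathbf z)f(\mathbf z)$; $M_\Phi$ is the (bounded) operator $f\mapsto\Phi f$, and $\Phi$ is contractive if $\|M_\Phi\|\le1$. *)

theory Defs
  imports "HOL-Analysis.Analysis" "HOL-Library.Function_Algebras"
begin

text \<open>
  A complex Hilbert space is given by a carrier inside an ambient type, so that the same notions
  apply to an abstract coefficient space and to a Hilbert space of functions.  The inner product
  is linear in the first argument.
\<close>

record 'a hspace =
  hcarrier :: "'a set"
  hscale :: "complex \<Rightarrow> 'a \<Rightarrow> 'a"
  hinner :: "'a \<Rightarrow> 'a \<Rightarrow> complex"

definition hnorm :: "'a hspace \<Rightarrow> 'a \<Rightarrow> real" where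
  "hnorm H x = sqrt (Re (hinner H x x))"

locale complex_hilbert_space =
  fixes H :: "'a::ab_group_add hspace"
  assumes vector_space_hscale: "vector_space (hscale H)"
    and subspace_hcarrier: "module.subspace (hscale H) (hcarrier H)"
    and hinner_add_left:
      "\<lbrakk>x \<in> hcarrier H; y \<in> hcarrier H; z \<in> hcarrier H\<rbrakk>
        \<Longrightarrow> hinner H (x + y) z = hinner H x z + hinner H y z"
    and hinner_scale_left:
      "\<lbrakk>x \<in> hcarrier H; y \<in> hcarrier H\<rbrakk> \<Longrightarrow> hinner H (hscale H c x) y = c * hinner H x y"
    and hinner_commute:
      "\<lbrakk>x \<in> hcarrier H; y \<in> hcarrier H\<rbrakk> \<Longrightarrow> hinner H x y = cnj (hinner H y x)"
    and hinner_nonneg: "x \<in> hcarrier H \<Longrightarrow> 0 \<le> Re (hinner H x x)"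
    and hinner_definite: "\<lbrakk>x \<in> hcarrier H; hinner H x x = 0\<rbrakk> \<Longrightarrow> x = 0"
    and complete:
      "\<lbrakk>\<And>i. X i \<in> hcarrier H;
        \<And>e. e > 0 \<Longrightarrow> \<exists>N. \<forall>i\<ge>N. \<forall>j\<ge>N. hnorm H (X i - X j) < e\<rbrakk>
        \<Longrightarrow> \<exists>l\<in>hcarrier H. (\<lambda>i. hnorm H (X i - l)) \<longlonglongrightarrow> 0"

definition bounded_operator :: "'a::ab_group_add hspace \<Rightarrow> ('a \<Rightarrow> 'a) \<Rightarrow> bool" where
  "bounded_operator H T \<longleftrightarrow>
     (\<forall>x\<in>hcarrier H. T x \<in> hcarrier H) \<and>
     (\<forall>x\<in>hcarrier H. \<forall>y\<in>hcarrier H. T (x + y) = T x + T y) \<and>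
     (\<forall>c. \<forall>x\<in>hcarrier H. T (hscale H c x) = hscale H c (T x)) \<and>
     (\<exists>C. \<forall>x\<in>hcarrier H. hnorm H (T x) \<le> C * hnorm H x)"

definition contraction_op :: "'a::ab_group_add hspace \<Rightarrow> ('a \<Rightarrow> 'a) \<Rightarrow> bool" where
  "contraction_op H T \<longleftrightarrow>
     bounded_operator H T \<and> (\<forall>x\<in>hcarrier H. hnorm H (T x) \<le> hnorm H x)"

definition hadjoint :: "'a hspace \<Rightarrow> ('a \<Rightarrow> 'a) \<Rightarrow> 'a \<Rightarrow> 'a" where
  "hadjoint H T y =
     (THE u. u \<in> hcarrier H \<and> (\<forall>x\<in>hcarrier H. hinner H (T x) y = hinner H x u))"

definition pure_contraction :: "'a::ab_group_add hspace \<Rightarrow> ('a \<Rightarrow> 'a) \<Rightarrow> bool" where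
  "pure_contraction H T \<longleftrightarrow>
     contraction_op H T \<and>
     (\<forall>h\<in>hcarrier H. (\<lambda>m. hnorm H ((hadjoint H T ^^ m) h)) \<longlonglongrightarrow> 0)"

definition polydisc :: "(complex ^ 'n) set" where
  "polydisc = {z. \<forall>i. norm (z $ i) < 1}"

definition hardy_kernel :: "complex ^ 'n \<Rightarrow> complex ^ 'n \<Rightarrow> complex" where
  "hardy_kernel z w = (\<Prod>i\<in>UNIV. inverse (1 - z $ i * cnj (w $ i)))"

definition bergman_kernel :: "complex ^ 'n \<Rightarrow> complex ^ 'n \<Rightarrow> complex" where
  "bergman_kernel z w = (\<Prod>i\<in>UNIV. inverse ((1 - z $ i * cnj (w $ i))\<^sup>2))"

definition dirichlet_kernel :: "complex ^ 'n \<Rightarrow> complex ^ 'n \<Rightarrow> complex" where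
  "dirichlet_kernel z w =
     (\<Prod>i\<in>UNIV. if z $ i * cnj (w $ i) = 0 then 1
        else - (1 / (z $ i * cnj (w $ i))) * ln (1 - z $ i * cnj (w $ i)))"

text \<open>
  Functions on the polydisc are represented by total functions vanishing outside it.  The
  reproducing kernel Hilbert space with kernel \<open>k(z,w) I\<close> is pinned down by the reproducing
  property: \<open>rkhs k E H\<close> determines the carrier of \<open>H\<close>, its (pointwise) vector space structure
  and its inner product on that carrier.
\<close>

definition kernel_fun ::
  "(complex ^ 'n \<Rightarrow> complex ^ 'n \<Rightarrow> complex) \<Rightarrow> 'e::ab_group_add hspace
    \<Rightarrow> complex ^ 'n \<Rightarrow> 'e \<Rightarrow> complex ^ 'n \<Rightarrow> 'e" where
  "kernel_fun k E w \<eta> = (\<lambda>z. if z \<in> polydisc then hscale E (k z w) \<eta> else 0)"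

definition rkhs ::
  "(complex ^ 'n \<Rightarrow> complex ^ 'n \<Rightarrow> complex) \<Rightarrow> 'e::ab_group_add hspace
    \<Rightarrow> (complex ^ 'n \<Rightarrow> 'e) hspace \<Rightarrow> bool" where
  "rkhs k E H \<longleftrightarrow>
     complex_hilbert_space H \<and>
     hscale H = (\<lambda>c f z. hscale E c (f z)) \<and>
     (\<forall>f\<in>hcarrier H. (\<forall>z\<in>polydisc. f z \<in> hcarrier E) \<and> (\<forall>z. z \<notin> polydisc \<longrightarrow> f z = 0)) \<and>
     (\<forall>w\<in>polydisc. \<forall>\<eta>\<in>hcarrier E.
        kernel_fun k E w \<eta> \<in> hcarrier H \<and>
        (\<forall>f\<in>hcarrier H. hinner H f (kernel_fun k E w \<eta>) = hinner E (f w) \<eta>))"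

definition mult_op ::
  "(complex ^ 'n \<Rightarrow> 'e \<Rightarrow> 'e) \<Rightarrow> (complex ^ 'n \<Rightarrow> 'e) \<Rightarrow> complex ^ 'n \<Rightarrow> 'e::ab_group_add" where
  "mult_op \<Phi> f = (\<lambda>z. if z \<in> polydisc then \<Phi> z (f z) else 0)"

definition Mult ::
  "'e::ab_group_add hspace \<Rightarrow> (complex ^ 'n \<Rightarrow> 'e) hspace \<Rightarrow> (complex ^ 'n \<Rightarrow> 'e \<Rightarrow> 'e) set" where
  "Mult E H = {\<Phi>. (\<forall>z\<in>polydisc. bounded_operator E (\<Phi> z)) \<and>
                  (\<forall>f\<in>hcarrier H. mult_op \<Phi> f \<in> hcarrier H)}"

end

theory Submission
  imports Defs
begin

text \<open>
  All three kernels are normalised by \<open>k(0,w) = 1\<close>, and \<open>M\<^sub>\<Phi>\<^sup>*\<close> sends \<open>k\<^sub>w \<eta>\<close> to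
  \<open>k\<^sub>w \<Phi>(w)\<^sup>* \<eta>\<close>; in particular it restricts to \<open>\<Phi>(0)\<^sup>*\<close> on the constants, which gives (i) to (ii).
  Conversely, let \<open>a\<^sub>j = \<parallel>\<Phi>(w)\<^sup>*\<^sup>j \<eta>\<parallel>\<close> and \<open>t\<^sub>j = \<parallel>M\<^sub>\<Phi>\<^sup>*\<^sup>j k\<^sub>w \<eta>\<parallel>\<close>, so that
  \<open>t\<^sub>j\<^sup>2 = k(w,w) a\<^sub>j\<^sup>2\<close> decreases to some \<open>L\<^sup>2\<close>.  Applying further powers of \<open>M\<^sub>\<Phi>\<^sup>*\<close>
  kills the constant part \<open>k\<^sub>0 \<xi>\<close> of \<open>k\<^sub>w \<xi>\<close>, where \<open>\<xi> = \<Phi>(w)\<^sup>*\<^sup>j \<eta>\<close>, so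
  \<open>L\<^sup>2 \<le> \<parallel>k\<^sub>w \<xi> - k\<^sub>0 \<xi>\<parallel>\<^sup>2 = (k(w,w) - 1) a\<^sub>j\<^sup>2\<close>.  Letting \<open>j\<close> tend to infinity forces \<open>L = 0\<close>,
  and the kernel functions are total.
\<close>

section \<open>Inner product geometry relative to a carrier\<close>

context complex_hilbert_space
begin

sublocale hs: vector_space "hscale H"
  by (rule vector_space_hscale)

lemma carrier_0 [simp]: "0 \<in> hcarrier H"
  and carrier_add [simp]: "\<lbrakk>x \<in> hcarrier H; y \<in> hcarrier H\<rbrakk> \<Longrightarrow> x + y \<in> hcarrier H"
  and carrier_diff [simp]: "\<lbrakk>x \<in> hcarrier H; y \<in> hcarrier H\<rbrakk> \<Longrightarrow> x - y \<in> hcarrier H"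
  and carrier_scale [simp]: "x \<in> hcarrier H \<Longrightarrow> hscale H c x \<in> hcarrier H"
  using subspace_hcarrier
  by (simp_all add: hs.subspace_0 hs.subspace_add hs.subspace_diff hs.subspace_scale)

lemma hinner_add_right:
  assumes "x \<in> hcarrier H" "y \<in> hcarrier H" "z \<in> hcarrier H"
  shows "hinner H x (y + z) = hinner H x y + hinner H x z"
  using assms hinner_commute[of x] by (simp add: hinner_add_left)

lemma hinner_scale_right:
  assumes "x \<in> hcarrier H" "y \<in> hcarrier H"
  shows "hinner H x (hscale H c y) = cnj c * hinner H x y"
  using assms hinner_commute[of x] by (simp add: hinner_scale_left)

lemma hinner_diff_left:
  assumes "x \<in> hcarrier H" "y \<in> hcarrier H" "z \<in> hcarrier H"
  shows "hinner H (x - y) z = hinner H x z - hinner H y z"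
  using hinner_add_left[of "x - y" y z] assms by simp

lemma hinner_diff_right:
  assumes "x \<in> hcarrier H" "y \<in> hcarrier H" "z \<in> hcarrier H"
  shows "hinner H x (y - z) = hinner H x y - hinner H x z"
  using hinner_add_right[of x "y - z" z] assms by simp

lemma hinner_0_left [simp]: "x \<in> hcarrier H \<Longrightarrow> hinner H 0 x = 0"
  using hinner_diff_left[of 0 0 x] by simp

lemma hinner_self:
  assumes "x \<in> hcarrier H"
  shows "hinner H x x = of_real ((hnorm H x)\<^sup>2)"
proof -
  have "hinner H x x \<in> \<real>"
    using hinner_commute[OF assms assms] by (simp add: Reals_cnj_iff)
  then show ?thesis
    using hinner_nonneg[OF assms] by (simp add: hnorm_def complex_is_Real_iff complex_eq_iff)
qed

lemma hnorm_sq: "x \<in> hcarrier H \<Longrightarrow> (hnorm H x)\<^sup>2 = Re (hinner H x x)"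
  by (simp add: hnorm_def hinner_nonneg)

lemma hnorm_nonneg [simp]: "x \<in> hcarrier H \<Longrightarrow> 0 \<le> hnorm H x"
  by (simp add: hnorm_def hinner_nonneg)

lemma hnorm_0 [simp]: "hnorm H 0 = 0"
  by (simp add: hnorm_def)

lemma hnorm_eq_0: "x \<in> hcarrier H \<Longrightarrow> hnorm H x = 0 \<longleftrightarrow> x = 0"
  using hinner_definite[of x] hinner_self[of x] by auto

lemma hnorm_add_sq:
  assumes "x \<in> hcarrier H" "y \<in> hcarrier H"
  shows "(hnorm H (x + y))\<^sup>2 = (hnorm H x)\<^sup>2 + 2 * Re (hinner H x y) + (hnorm H y)\<^sup>2"
  using assms hinner_commute[of y x]
  by (simp add: hnorm_sq hinner_add_left hinner_add_right)

lemma hnorm_diff_sq: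
  assumes "x \<in> hcarrier H" "y \<in> hcarrier H"
  shows "(hnorm H (x - y))\<^sup>2 = (hnorm H x)\<^sup>2 - 2 * Re (hinner H x y) + (hnorm H y)\<^sup>2"
  using assms hinner_commute[of y x]
  by (simp add: hnorm_sq hinner_diff_left hinner_diff_right)

lemma hnorm_scale:
  assumes "x \<in> hcarrier H"
  shows "hnorm H (hscale H c x) = cmod c * hnorm H x"
proof -
  have "hinner H (hscale H c x) (hscale H c x) = (c * cnj c) * of_real ((hnorm H x)\<^sup>2)"
    using assms hinner_self[OF assms] by (simp add: hinner_scale_left hinner_scale_right)
  then have "hinner H (hscale H c x) (hscale H c x) = of_real ((cmod c * hnorm H x)\<^sup>2)"
    by (simp add: power_mult_distrib flip: complex_norm_square)
  then show ?thesis
    using assms by (simp add: hnorm_def[of H "hscale H c x"])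
qed

lemma Cauchy_Schwarz:
  assumes x: "x \<in> hcarrier H" and y: "y \<in> hcarrier H"
  shows "cmod (hinner H x y) \<le> hnorm H x * hnorm H y"
proof (cases "y = 0")
  case True
  then show ?thesis
    using hinner_commute[of x 0] x by simp
next
  case False
  define b where "b = (hnorm H y)\<^sup>2"
  have b: "b > 0"
    using False y hnorm_eq_0[of y] by (simp add: b_def)
  define c where "c = hinner H x y"
  \<comment> \<open>The vector \<open>(c/b) y\<close> is the orthogonal projection of
    \<open>x\<close> onto the line through \<open>y\<close>; expanding the squared distance gives
    the inequality.\<close>
  have "0 \<le> (hnorm H (x - hscale H (c / of_real b) y))\<^sup>2"
    by simp
  also have "\<dots> = (hnorm H x)\<^sup>2 - 2 * Re (cnj (c / of_real b) * c) + (cmod (c / of_real b))\<^sup>2 * b"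
    using x y by (simp add: hnorm_diff_sq hinner_scale_right hnorm_scale b_def c_def power_mult_distrib)
  also have "Re (cnj (c / of_real b) * c) = (cmod c)\<^sup>2 / b"
    by (simp only: cmod_power2) (simp add: power2_eq_square add_divide_distrib)
  also have "(cmod (c / of_real b))\<^sup>2 * b = (cmod c)\<^sup>2 / b"
    using b by (simp add: norm_divide power_divide power2_eq_square)
  finally have "(cmod c)\<^sup>2 / b \<le> (hnorm H x)\<^sup>2"
    by simp
  then have "(cmod c)\<^sup>2 \<le> (hnorm H x * hnorm H y)\<^sup>2"
    using b by (simp add: field_simps b_def)
  then show ?thesis
    using x y by (simp add: c_def power2_le_iff_abs_le)
qed

lemma hnorm_triangle:
  assumes x: "x \<in> hcarrier H" and y: "y \<in> hcarrier H"
  shows "hnorm H (x + y) \<le> hnorm H x + hnorm H y"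
proof -
  have "(hnorm H (x + y))\<^sup>2 \<le> (hnorm H x)\<^sup>2 + 2 * (hnorm H x * hnorm H y) + (hnorm H y)\<^sup>2"
    using Cauchy_Schwarz[OF x y] complex_Re_le_cmod[of "hinner H x y"] x y
    by (simp add: hnorm_add_sq)
  then have "(hnorm H (x + y))\<^sup>2 \<le> (hnorm H x + hnorm H y)\<^sup>2"
    by (simp add: power2_sum)
  then show ?thesis
    using x y by (simp add: power2_le_iff_abs_le)
qed

lemma hnorm_minus_commute:
  assumes "x \<in> hcarrier H" "y \<in> hcarrier H"
  shows "hnorm H (x - y) = hnorm H (y - x)"
  using hnorm_scale[of "y - x" "-1"] assms by simp

lemma hnorm_diff_ineq:
  assumes "x \<in> hcarrier H" "y \<in> hcarrier H"
  shows "\<bar>hnorm H x - hnorm H y\<bar> \<le> hnorm H (x - y)"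
  using hnorm_triangle[of "x - y" y] hnorm_triangle[of "y - x" x] hnorm_minus_commute[of x y] assms
  by simp

section \<open>The Riesz representation theorem\<close>

text \<open>The representing vector minimises \<open>\<parallel>x\<parallel>\<^sup>2 - 2 Re (f x)\<close>; the parallelogram law makes
  minimising sequences Cauchy.\<close>

theorem Riesz_representation:
  assumes add: "\<And>x y. \<lbrakk>x \<in> hcarrier H; y \<in> hcarrier H\<rbrakk> \<Longrightarrow> f (x + y) = f x + f y"
    and scale: "\<And>c x. x \<in> hcarrier H \<Longrightarrow> f (hscale H c x) = c * f x"
    and bound: "\<And>x. x \<in> hcarrier H \<Longrightarrow> cmod (f x) \<le> C * hnorm H x"
  obtains u where "u \<in> hcarrier H" "\<And>x. x \<in> hcarrier H \<Longrightarrow> f x = hinner H x u"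
proof -
  define J where "J x = (hnorm H x)\<^sup>2 - 2 * Re (f x)" for x
  have lower: "- C\<^sup>2 \<le> J x" if "x \<in> hcarrier H" for x
  proof -
    have "Re (f x) \<le> C * hnorm H x"
      using bound[OF that] complex_Re_le_cmod[of "f x"] by linarith
    \<comment> \<open>Completing the square turns the linear bound on \<open>f\<close> into a lower
      bound for \<open>J\<close>.\<close>
    moreover have "0 \<le> (hnorm H x - C)\<^sup>2"
      by simp
    ultimately show ?thesis
      by (simp add: J_def power2_diff algebra_simps)
  qed
  define d where "d = Inf (J ` hcarrier H)"
  have bdd: "bdd_below (J ` hcarrier H)"
    using lower by (auto intro!: bdd_belowI)
  have d_le: "d \<le> J x" if "x \<in> hcarrier H" for x
    unfolding d_def using bdd that by (simp add: cINF_lower)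
  have "\<exists>x\<in>hcarrier H. J x < d + inverse (real (Suc n))" for n
  proof -
    have "\<exists>t\<in>J ` hcarrier H. t < d + inverse (real (Suc n))"
    proof (rule cInf_lessD)
      show "J ` hcarrier H \<noteq> {}"
        using carrier_0 by blast
    qed (simp add: d_def)
    then show ?thesis
      by blast
  qed
  then obtain X where X: "\<And>n. X n \<in> hcarrier H" and JX: "\<And>n. J (X n) < d + inverse (real (Suc n))"
    by metis
  have gap: "(hnorm H (x - y))\<^sup>2 \<le> 2 * (J x + J y - 2 * d)"
    if x: "x \<in> hcarrier H" and y: "y \<in> hcarrier H" for x y
  proof -
    \<comment> \<open>Comparing \<open>d\<close> with \<open>J\<close> at the midpoint bounds the
      distance of \<open>x\<close> and \<open>y\<close> by their excess over the infimum.\<close>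
    have "d \<le> J (hscale H (1/2) (x + y))"
      using x y by (simp add: d_le)
    also have "\<dots> = (hnorm H (x + y))\<^sup>2 / 4 - Re (f x) - Re (f y)"
      using x y by (simp add: J_def hnorm_scale scale add power_divide norm_divide add_divide_distrib
          del: hs.scale_right_distrib)
    finally have "4 * (d + Re (f x) + Re (f y)) \<le> (hnorm H (x + y))\<^sup>2"
      by simp
    moreover have "(hnorm H (x - y))\<^sup>2 = 2 * (hnorm H x)\<^sup>2 + 2 * (hnorm H y)\<^sup>2 - (hnorm H (x + y))\<^sup>2"
      using x y by (simp add: hnorm_add_sq hnorm_diff_sq)
    ultimately show ?thesis
      by (simp add: J_def)
  qed
  have "\<exists>l\<in>hcarrier H. (\<lambda>i. hnorm H (X i - l)) \<longlonglongrightarrow> 0"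
  proof (rule complete)
    fix e :: real
    assume e: "e > 0"
    \<comment> \<open>Two excesses below \<open>e^2/4\<close> each, doubled by \<open>gap\<close>,
      add up to less than \<open>e^2\<close>.\<close>
    obtain N where N: "inverse (real (Suc N)) < e\<^sup>2 / 4"
      using reals_Archimedean[of "e\<^sup>2 / 4"] e by auto
    have "hnorm H (X i - X j) < e" if "i \<ge> N" "j \<ge> N" for i j
    proof -
      have "inverse (real (Suc i)) < e\<^sup>2 / 4" "inverse (real (Suc j)) < e\<^sup>2 / 4"
        using that by (intro le_less_trans[OF _ N] le_imp_inverse_le; simp)+
      then have "(hnorm H (X i - X j))\<^sup>2 < e\<^sup>2"
        using gap[OF X X, of i j] JX[of i] JX[of j] by argo
      then show ?thesis
        using e by (simp add: power_less_imp_less_base)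
    qed
    then show "\<exists>N. \<forall>i\<ge>N. \<forall>j\<ge>N. hnorm H (X i - X j) < e"
      by blast
  qed (rule X)
  then obtain u where u: "u \<in> hcarrier H" and lim: "(\<lambda>i. hnorm H (X i - u)) \<longlonglongrightarrow> 0"
    by blast
  have diff: "f (x - y) = f x - f y" if "x \<in> hcarrier H" "y \<in> hcarrier H" for x y
    using add[of "x - y" y] that by simp
  have "(\<lambda>i. hnorm H (X i) - hnorm H u) \<longlonglongrightarrow> 0"
    by (rule Lim_null_comparison[OF _ lim]) (simp add: hnorm_diff_ineq X u)
  then have lim_norm: "(\<lambda>i. hnorm H (X i)) \<longlonglongrightarrow> hnorm H u"
    by (simp add: LIM_zero_iff)
  have "(\<lambda>i. C * hnorm H (X i - u)) \<longlonglongrightarrow> 0"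
    using tendsto_mult_left[OF lim, of C] by simp
  then have "(\<lambda>i. f (X i) - f u) \<longlonglongrightarrow> 0"
    by (rule Lim_null_comparison[rotated]) (simp add: bound X u flip: diff)
  then have lim_f: "(\<lambda>i. f (X i)) \<longlonglongrightarrow> f u"
    by (simp add: LIM_zero_iff)
  have "(\<lambda>i. J (X i)) \<longlonglongrightarrow> J u"
    unfolding J_def by (intro tendsto_intros lim_norm lim_f)
  moreover have "(\<lambda>n. d + inverse (real (Suc n))) \<longlonglongrightarrow> d + 0"
    by (intro tendsto_intros LIMSEQ_inverse_real_of_nat)
  ultimately have Ju: "J u \<le> d"
    using JX by (intro LIMSEQ_le[of _ "J u" _ d]) (auto intro: less_imp_le)
  have "f y = hinner H y u" if y: "y \<in> hcarrier H" for y
  proof -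
    \<comment> \<open>The number \<open>c\<close> governs the first variation of \<open>J\<close> at
      the minimiser \<open>u\<close> in direction \<open>y\<close>. The step \<open>t\<close> points
      downhill, and \<open>s\<close> is small enough for the linear gain to beat the quadratic term;
      the \<open>+ 1\<close> covers \<open>y = 0\<close>. Hence minimality forces
      \<open>c = 0\<close>.\<close>
    define c where "c = hinner H y u - f y"
    define s where "s = 1 / ((hnorm H y)\<^sup>2 + 1)"
    define t where "t = - (of_real s * cnj c)"
    have "J u \<le> J (u + hscale H t y)"
      using Ju d_le[of "u + hscale H t y"] u y by simp
    also have "\<dots> = J u + 2 * Re (t * c) + (cmod t * hnorm H y)\<^sup>2"
      using u y hinner_commute[of u "hscale H t y"]
      by (simp add: J_def hnorm_add_sq hnorm_scale add scale hinner_scale_left c_def algebra_simps)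
    also have "Re (t * c) = - s * (cmod c)\<^sup>2"
      by (simp only: t_def cmod_power2) (simp add: power2_eq_square algebra_simps)
    also have "(cmod t * hnorm H y)\<^sup>2 = s\<^sup>2 * (cmod c)\<^sup>2 * (hnorm H y)\<^sup>2"
      by (simp add: t_def norm_mult power_mult_distrib)
    finally have "0 \<le> s * (cmod c)\<^sup>2 * (s * (hnorm H y)\<^sup>2 - 2)"
      by (simp add: algebra_simps power2_eq_square)
    moreover have "s > 0" "s * (hnorm H y)\<^sup>2 < 2"
      by (auto simp: s_def field_simps add_pos_nonneg intro!: add_strict_increasing)
    ultimately have "cmod c = 0"
      by (smt (verit, best) mult_pos_neg mult_pos_pos zero_less_power2)
    then show ?thesis
      by (simp add: c_def)
  qed
  with u show ?thesis
    using that by blast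
qed

section \<open>Adjoints and powers of contractions\<close>

text \<open>The difference of two candidates is orthogonal to itself, so the definite description in
  \<open>hadjoint\<close> is met by any candidate. Adjoints are computed below by exhibiting
  one.\<close>

lemma hadjoint_unique:
  assumes u: "u \<in> hcarrier H" and eq: "\<And>x. x \<in> hcarrier H \<Longrightarrow> hinner H (T x) y = hinner H x u"
  shows "hadjoint H T y = u"
  unfolding hadjoint_def
proof (rule the_equality)
  fix v
  assume v: "v \<in> hcarrier H \<and> (\<forall>x\<in>hcarrier H. hinner H (T x) y = hinner H x v)"
  then have "hinner H (v - u) v = hinner H (v - u) u"
    using u eq by (metis carrier_diff)
  then have "hinner H (v - u) (v - u) = 0"
    using u v by (simp add: hinner_diff_right)
  then show "v = u"
    using hinner_definite[of "v - u"] u v by simp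
qed (use assms in blast)

text \<open>Existence of the adjoint: Riesz applied to \<open>x\<close> \<mapsto>
  \<open>hinner H (T x) y\<close>, which is bounded with constant
  \<open>C * hnorm H y\<close>.\<close>

lemma
  assumes T: "bounded_operator H T" and y: "y \<in> hcarrier H"
  shows hadjoint_carrier: "hadjoint H T y \<in> hcarrier H"
    and hinner_hadjoint: "x \<in> hcarrier H \<Longrightarrow> hinner H (T x) y = hinner H x (hadjoint H T y)"
proof -
  obtain C where C: "\<And>x. x \<in> hcarrier H \<Longrightarrow> hnorm H (T x) \<le> C * hnorm H x"
    using T unfolding bounded_operator_def by blast
  have bound: "cmod (hinner H (T x) y) \<le> (C * hnorm H y) * hnorm H x" if x: "x \<in> hcarrier H" for x
  proof -
    have "cmod (hinner H (T x) y) \<le> hnorm H (T x) * hnorm H y"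
      using T x y by (simp add: Cauchy_Schwarz bounded_operator_def)
    also have "\<dots> \<le> C * hnorm H x * hnorm H y"
      using C[OF x] y by (simp add: mult_right_mono)
    finally show ?thesis
      by (simp add: mult_ac)
  qed
  obtain u where u: "u \<in> hcarrier H" "\<And>x. x \<in> hcarrier H \<Longrightarrow> hinner H (T x) y = hinner H x u"
  proof (rule Riesz_representation[where f = "\<lambda>x. hinner H (T x) y"])
    show "cmod (hinner H (T x) y) \<le> (C * hnorm H y) * hnorm H x" if "x \<in> hcarrier H" for x
      using that by (rule bound)
  qed (use T y in \<open>auto simp: bounded_operator_def hinner_add_left hinner_scale_left\<close>)
  with hadjoint_unique[of u T y]
  show "hadjoint H T y \<in> hcarrier H"
    and "x \<in> hcarrier H \<Longrightarrow> hinner H (T x) y = hinner H x (hadjoint H T y)"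
    by simp_all
qed

text \<open>With \<open>u = hadjoint H T y\<close>, the square of the norm of \<open>u\<close> is
  \<open>Re (hinner H (T u) y)\<close>, at most \<open>hnorm H u * hnorm H y\<close>; one factor
  cancels. Linearity follows from uniqueness of the adjoint.\<close>

lemma contraction_op_hadjoint:
  assumes "contraction_op H T"
  shows "contraction_op H (hadjoint H T)"
proof -
  have T: "bounded_operator H T" and T_carrier: "\<And>x. x \<in> hcarrier H \<Longrightarrow> T x \<in> hcarrier H"
    and T_norm: "\<And>x. x \<in> hcarrier H \<Longrightarrow> hnorm H (T x) \<le> hnorm H x"
    using assms by (auto simp: contraction_op_def bounded_operator_def)
  have norm: "hnorm H (hadjoint H T y) \<le> hnorm H y" if y: "y \<in> hcarrier H" for y
  proof -
    let ?u = "hadjoint H T y"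
    have u: "?u \<in> hcarrier H"
      using T y by (rule hadjoint_carrier)
    have "(hnorm H ?u)\<^sup>2 = Re (hinner H (T ?u) y)"
      by (simp add: hnorm_sq u hinner_hadjoint T y)
    also have "\<dots> \<le> hnorm H (T ?u) * hnorm H y"
      using Cauchy_Schwarz[of "T ?u" y] u y T_carrier complex_Re_le_cmod order_trans by blast
    also have "\<dots> \<le> hnorm H ?u * hnorm H y"
      using T_norm u y by (simp add: mult_right_mono)
    finally show ?thesis
      using u y hnorm_nonneg[OF u] by (cases "hnorm H ?u = 0") (auto simp: power2_eq_square)
  qed
  have "hadjoint H T (x + y) = hadjoint H T x + hadjoint H T y"
    if "x \<in> hcarrier H" "y \<in> hcarrier H" for x y
    by (rule hadjoint_unique)
      (use that in \<open>simp_all add: hadjoint_carrier[OF T] hinner_add_right T_carrier hinner_hadjoint[OF T]\<close>)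
  moreover have "hadjoint H T (hscale H c x) = hscale H c (hadjoint H T x)"
    if "x \<in> hcarrier H" for c x
    by (rule hadjoint_unique)
      (use that in \<open>simp_all add: hadjoint_carrier[OF T] hinner_scale_right T_carrier hinner_hadjoint[OF T]\<close>)
  moreover have "\<exists>C. \<forall>x\<in>hcarrier H. hnorm H (hadjoint H T x) \<le> C * hnorm H x"
    using norm by (intro exI[of _ 1]) simp
  ultimately show ?thesis
    using norm by (simp add: contraction_op_def bounded_operator_def hadjoint_carrier[OF T])
qed

lemma contraction_op_funpow:
  assumes "contraction_op H S"
  shows "contraction_op H (S ^^ m)"
proof (induction m)
  case 0
  show ?case
    by (auto simp: contraction_op_def bounded_operator_def intro!: exI[of _ 1])
next
  case (Suc m)
  have "hnorm H ((S ^^ Suc m) x) \<le> hnorm H x" if "x \<in> hcarrier H" for x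
    using assms Suc.IH that
    by (auto simp: contraction_op_def bounded_operator_def intro: order_trans[of _ "hnorm H ((S ^^ m) x)"])
  then show ?case
    using assms Suc.IH
    by (auto simp: contraction_op_def bounded_operator_def intro!: exI[of _ 1])
qed

section \<open>Totality and strong stability\<close>

text \<open>A closed subspace is itself a Hilbert space, so Riesz inside \<open>M\<close> represents
  \<open>y\<close> \<mapsto> \<open>hinner H y x\<close> by some \<open>u\<close> in
  \<open>M\<close>, the projection of \<open>x\<close>. Then \<open>x - u\<close> is orthogonal to
  \<open>M\<close>, hence zero.\<close>

lemma closed_subspace_eq_carrier:
  assumes subset: "M \<subseteq> hcarrier H" and M: "hs.subspace M"
    and closed: "\<And>X l. \<lbrakk>\<And>i. X i \<in> M; l \<in> hcarrier H; (\<lambda>i. hnorm H (X i - l)) \<longlonglongrightarrow> 0\<rbrakk> \<Longrightarrow> l \<in> M"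
    and total: "\<And>x. \<lbrakk>x \<in> hcarrier H; \<And>y. y \<in> M \<Longrightarrow> hinner H y x = 0\<rbrakk> \<Longrightarrow> x = 0"
  shows "M = hcarrier H"
proof (rule antisym[OF subset subsetI])
  fix x
  assume x: "x \<in> hcarrier H"
  have hnorm_M [simp]: "hnorm (H\<lparr>hcarrier := M\<rparr>) = hnorm H"
    by (simp add: hnorm_def fun_eq_iff)
  have in_H: "y \<in> hcarrier H" if "y \<in> M" for y
    using that subset by blast
  interpret M: complex_hilbert_space "H\<lparr>hcarrier := M\<rparr>"
  proof
    fix X
    assume X: "\<And>i::nat. X i \<in> hcarrier (H\<lparr>hcarrier := M\<rparr>)"
      and Cauchy: "\<And>e. e > 0 \<Longrightarrow> \<exists>N. \<forall>i\<ge>N. \<forall>j\<ge>N. hnorm (H\<lparr>hcarrier := M\<rparr>) (X i - X j) < e"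
    have "\<exists>l\<in>hcarrier H. (\<lambda>i. hnorm H (X i - l)) \<longlonglongrightarrow> 0"
      using X Cauchy by (intro complete) (auto simp: in_H)
    then show "\<exists>l\<in>hcarrier (H\<lparr>hcarrier := M\<rparr>). (\<lambda>i. hnorm (H\<lparr>hcarrier := M\<rparr>) (X i - l)) \<longlonglongrightarrow> 0"
      using closed[of X] X by auto
  qed (use M in \<open>auto simp: in_H hinner_add_left hinner_scale_left hinner_nonneg hinner_definite
        vector_space_hscale hs.scale_right_distrib hs.scale_left_distrib intro: hinner_commute\<close>)
  obtain u where u: "u \<in> M" "\<And>y. y \<in> M \<Longrightarrow> hinner H y x = hinner H y u"
  proof (rule M.Riesz_representation[where f = "\<lambda>y. hinner H y x" and C = "hnorm H x"])
    show "cmod (hinner H y x) \<le> hnorm H x * hnorm (H\<lparr>hcarrier := M\<rparr>) y"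
      if "y \<in> hcarrier (H\<lparr>hcarrier := M\<rparr>)" for y
      using Cauchy_Schwarz[of y x] that x by (simp add: in_H mult_ac)
  qed (use x in \<open>auto simp: in_H hinner_add_left hinner_scale_left\<close>)
  have "x - u = 0"
    by (rule total) (use x u in \<open>simp_all add: in_H hinner_diff_right\<close>)
  then show "x \<in> M"
    using u by simp
qed

text \<open>The vectors with stable orbit form a subspace, closed because all powers of
  \<open>S\<close> have norm at most 1. It contains the total set \<open>D\<close>, so it is
  everything.\<close>

lemma strongly_stable_if_total:
  assumes S: "contraction_op H S"
    and total: "\<And>x. \<lbrakk>x \<in> hcarrier H; \<And>y. y \<in> D \<Longrightarrow> hinner H y x = 0\<rbrakk> \<Longrightarrow> x = 0"
    and D: "D \<subseteq> hcarrier H" "\<And>y. y \<in> D \<Longrightarrow> (\<lambda>m. hnorm H ((S ^^ m) y)) \<longlonglongrightarrow> 0"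
    and h: "h \<in> hcarrier H"
  shows "(\<lambda>m. hnorm H ((S ^^ m) h)) \<longlonglongrightarrow> 0"
proof -
  define N where "N = {h \<in> hcarrier H. (\<lambda>m. hnorm H ((S ^^ m) h)) \<longlonglongrightarrow> 0}"
  have Sm_carrier: "(S ^^ m) x \<in> hcarrier H"
    and Sm_norm: "hnorm H ((S ^^ m) x) \<le> hnorm H x"
    and Sm_scale: "(S ^^ m) (hscale H c x) = hscale H c ((S ^^ m) x)"
    if "x \<in> hcarrier H" for m x c
    using contraction_op_funpow[OF S, of m] that
    by (auto simp: contraction_op_def bounded_operator_def)
  have Sm_add: "(S ^^ m) (x + y) = (S ^^ m) x + (S ^^ m) y"
    if "x \<in> hcarrier H" "y \<in> hcarrier H" for m x y
    using contraction_op_funpow[OF S, of m] that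
    by (auto simp: contraction_op_def bounded_operator_def)
  \<comment> \<open>The error term is uniform in \<open>m\<close>, which is what closedness of
    \<open>N\<close> requires.\<close>
  have near: "hnorm H ((S ^^ m) l) \<le> hnorm H ((S ^^ m) x) + hnorm H (x - l)"
    if x: "x \<in> hcarrier H" and l: "l \<in> hcarrier H" for m x l
  proof -
    have "hnorm H ((S ^^ m) l) = hnorm H ((S ^^ m) x + (S ^^ m) (l - x))"
      using Sm_add[of x "l - x" m] x l by simp
    also have "\<dots> \<le> hnorm H ((S ^^ m) x) + hnorm H ((S ^^ m) (l - x))"
      using x l by (intro hnorm_triangle Sm_carrier) auto
    also have "hnorm H ((S ^^ m) (l - x)) \<le> hnorm H (x - l)"
      using Sm_norm[of "l - x" m] hnorm_minus_commute[of x l] x l by simp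
    finally show ?thesis
      by simp
  qed
  have "N = hcarrier H"
  proof (rule closed_subspace_eq_carrier)
    show "hs.subspace N"
    proof (rule hs.subspaceI)
      have "hnorm H ((S ^^ m) 0) = 0" for m
        using Sm_norm[of 0 m] hnorm_nonneg[OF Sm_carrier[of 0 m]] by simp
      then show "0 \<in> N"
        by (simp add: N_def)
    next
      fix x y
      assume "x \<in> N" "y \<in> N"
      then have xy: "x \<in> hcarrier H" "y \<in> hcarrier H"
        and lim: "(\<lambda>m. hnorm H ((S ^^ m) x) + hnorm H ((S ^^ m) y)) \<longlonglongrightarrow> 0"
        by (auto simp: N_def intro: tendsto_add_zero)
      have "(\<lambda>m. hnorm H ((S ^^ m) (x + y))) \<longlonglongrightarrow> 0"
        by (rule tendsto_sandwich[OF _ _ tendsto_const lim])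
          (use xy in \<open>auto simp: Sm_add Sm_carrier intro!: hnorm_triangle always_eventually\<close>)
      then show "x + y \<in> N"
        using xy by (simp add: N_def)
    next
      fix c x
      assume "x \<in> N"
      then show "hscale H c x \<in> N"
        by (auto simp: N_def Sm_scale Sm_carrier hnorm_scale intro!: tendsto_mult_right_zero)
    qed
  next
    fix X l
    assume X: "\<And>i::nat. X i \<in> N" and l: "l \<in> hcarrier H"
      and lim: "(\<lambda>i. hnorm H (X i - l)) \<longlonglongrightarrow> 0"
    have "(\<lambda>m. hnorm H ((S ^^ m) l)) \<longlonglongrightarrow> 0"
    proof (rule LIMSEQ_I)
      fix e :: real
      assume e: "e > 0"
      obtain i where i: "hnorm H (X i - l) < e / 2"
        using order_tendstoD(2)[OF lim, of "e / 2"] e by (auto simp: eventually_sequentially)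
      have Xi: "X i \<in> hcarrier H" "(\<lambda>m. hnorm H ((S ^^ m) (X i))) \<longlonglongrightarrow> 0"
        using X[of i] by (auto simp: N_def)
      obtain m0 where m0: "\<And>m. m \<ge> m0 \<Longrightarrow> hnorm H ((S ^^ m) (X i)) < e / 2"
        using order_tendstoD(2)[OF Xi(2), of "e / 2"] e by (auto simp: eventually_sequentially)
      have "norm (hnorm H ((S ^^ m) l) - 0) < e" if "m \<ge> m0" for m
        using near[OF Xi(1) l, of m] i m0[OF that] hnorm_nonneg[OF Sm_carrier[OF l, of m]] by simp
      then show "\<exists>m0. \<forall>m\<ge>m0. norm (hnorm H ((S ^^ m) l) - 0) < e"
        by blast
    qed
    with l show "l \<in> N"
      by (simp add: N_def)
  next
    fix x
    assume "x \<in> hcarrier H" "\<And>y. y \<in> N \<Longrightarrow> hinner H y x = 0"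
    then show "x = 0"
      using D by (intro total) (auto simp: N_def)
  qed (auto simp: N_def)
  with h show ?thesis
    by (auto simp: N_def)
qed

end

section \<open>Multipliers acting on kernel functions\<close>

text \<open>Stated for an abstract kernel: normalisation at 0 is the property through which the
  concrete kernels enter.\<close>

lemma pure_contraction_mult_op_iff:
  fixes E :: "'e::ab_group_add hspace"
    and k :: "complex ^ 'n \<Rightarrow> complex ^ 'n \<Rightarrow> complex"
    and H :: "(complex ^ 'n \<Rightarrow> 'e) hspace"
  assumes E: "complex_hilbert_space E"
    and normalized: "\<And>w. w \<in> polydisc \<Longrightarrow> k 0 w = 1"
    and rkhs: "rkhs k E H"
    and Mult: "\<Phi> \<in> Mult E H"
    and contraction: "contraction_op H (mult_op \<Phi>)"
  shows "pure_contraction H (mult_op \<Phi>) \<longleftrightarrow> pure_contraction E (\<Phi> 0)"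
proof -
  interpret E: complex_hilbert_space E
    by (rule E)
  interpret H: complex_hilbert_space H
    using rkhs by (simp add: rkhs_def)
  define K where "K = kernel_fun k E"
  define S where "S = hadjoint H (mult_op \<Phi>)"
  define A where "A w = hadjoint E (\<Phi> w)" for w
  have zero [simp]: "0 \<in> polydisc"
    by (simp add: polydisc_def)
  have val: "f w \<in> hcarrier E" if "f \<in> hcarrier H" "w \<in> polydisc" for f w
    using rkhs that by (auto simp: rkhs_def)
  have outside: "f w = 0" if "f \<in> hcarrier H" "w \<notin> polydisc" for f w
    using rkhs that by (auto simp: rkhs_def)
  have K: "K w \<eta> \<in> hcarrier H" if "w \<in> polydisc" "\<eta> \<in> hcarrier E" for w \<eta>
    using rkhs that by (auto simp: rkhs_def K_def)
  have reproducing: "hinner H f (K w \<eta>) = hinner E (f w) \<eta>"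
    if "f \<in> hcarrier H" "w \<in> polydisc" "\<eta> \<in> hcarrier E" for f w \<eta>
    using rkhs that by (auto simp: rkhs_def K_def)
  have K_apply: "K w \<eta> z = hscale E (k z w) \<eta>" if "z \<in> polydisc" for w \<eta> z
    using that by (simp add: K_def kernel_fun_def)
  have bounded: "bounded_operator E (\<Phi> w)" if "w \<in> polydisc" for w
    using Mult that by (simp add: Mult_def)
  have A: "A w \<eta> \<in> hcarrier E" if "w \<in> polydisc" "\<eta> \<in> hcarrier E" for w \<eta>
    using that by (simp add: A_def E.hadjoint_carrier bounded)
  \<comment> \<open>Pairing with any \<open>f\<close>, the reproducing property reduces the adjoint
    relation on \<open>H\<close> to the one for \<open>\<Phi> w\<close> at the value
    \<open>f w\<close>.\<close>
  have S_K: "S (K w \<eta>) = K w (A w \<eta>)" if w: "w \<in> polydisc" and \<eta>: "\<eta> \<in> hcarrier E" for w \<eta>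
    unfolding S_def
  proof (rule H.hadjoint_unique)
    fix f
    assume f: "f \<in> hcarrier H"
    have "mult_op \<Phi> f \<in> hcarrier H"
      using Mult f by (simp add: Mult_def)
    then have "hinner H (mult_op \<Phi> f) (K w \<eta>) = hinner E (\<Phi> w (f w)) \<eta>"
      using w \<eta> by (simp add: reproducing mult_op_def)
    also have "\<dots> = hinner E (f w) (A w \<eta>)"
      unfolding A_def by (rule E.hinner_hadjoint[OF bounded[OF w] \<eta> val[OF f w]])
    finally show "hinner H (mult_op \<Phi> f) (K w \<eta>) = hinner H f (K w (A w \<eta>))"
      using f w \<eta> by (simp add: reproducing A)
  qed (use w \<eta> in \<open>simp add: K A\<close>)
  have A_funpow: "(A w ^^ m) \<eta> \<in> hcarrier E" if "w \<in> polydisc" "\<eta> \<in> hcarrier E" for w \<eta> m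
    using that by (induction m) (auto simp: A)
  have S_funpow: "(S ^^ m) (K w \<eta>) = K w ((A w ^^ m) \<eta>)"
    if "w \<in> polydisc" "\<eta> \<in> hcarrier E" for w \<eta> m
    using that by (induction m) (auto simp: S_K A_funpow)
  have norm_K: "(hnorm H (K w \<eta>))\<^sup>2 = Re (k w w) * (hnorm E \<eta>)\<^sup>2"
    if "w \<in> polydisc" "\<eta> \<in> hcarrier E" for w \<eta>
    using that
    by (simp add: H.hnorm_sq K reproducing K_apply E.hinner_scale_left E.hinner_self)
  \<comment> \<open>\<open>K 0\<close> is an isometry; with \<open>S_funpow\<close> at
    \<open>w = 0\<close> it transports orbits of \<open>A 0\<close> to orbits of \<open>S\<close>,
    in both directions of the equivalence.\<close>
  have norm_K_0: "hnorm H (K 0 \<eta>) = hnorm E \<eta>" if "\<eta> \<in> hcarrier E" for \<eta>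
    using norm_K[of 0 \<eta>] that by (simp add: normalized K)
  \<comment> \<open>Evaluating \<open>K w \<eta>\<close> at 0 gives \<eta>, so
    \<open>K w \<eta> - K 0 \<eta>\<close> is orthogonal to \<open>K 0 \<eta>\<close> and Pythagoras
    applies.\<close>
  have norm_K_diff: "(hnorm H (K w \<eta> - K 0 \<eta>))\<^sup>2 = (Re (k w w) - 1) * (hnorm E \<eta>)\<^sup>2"
    if "w \<in> polydisc" "\<eta> \<in> hcarrier E" for w \<eta>
    using that
    by (simp add: H.hnorm_diff_sq K norm_K norm_K_0 reproducing K_apply normalized E.hinner_self
        algebra_simps)
  have contraction_S: "contraction_op H S"
    unfolding S_def by (rule H.contraction_op_hadjoint[OF contraction])
  show ?thesis
  proof
    assume pure: "pure_contraction H (mult_op \<Phi>)"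
    have "hnorm E (\<Phi> 0 \<eta>) \<le> hnorm E \<eta>" if \<eta>: "\<eta> \<in> hcarrier E" for \<eta>
    proof -
      \<comment> \<open>Since \<open>f 0 = \<Phi> 0 \<eta>\<close>, the bound follows once
        evaluation at 0 is contractive; that is Cauchy-Schwarz against
        \<open>K 0 (f 0)\<close>.\<close>
      define f where "f = mult_op \<Phi> (K 0 \<eta>)"
      have f: "f \<in> hcarrier H"
        using Mult \<eta> by (simp add: Mult_def K f_def)
      have f_0: "f 0 = \<Phi> 0 \<eta>"
        by (simp add: f_def mult_op_def K_apply normalized)
      have "(hnorm E (f 0))\<^sup>2 = Re (hinner H f (K 0 (f 0)))"
        using f by (simp add: E.hnorm_sq reproducing val)
      also have "\<dots> \<le> hnorm H f * hnorm H (K 0 (f 0))"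
        using H.Cauchy_Schwarz[of f "K 0 (f 0)"] f complex_Re_le_cmod order_trans
        by (blast intro: K val zero)
      also have "\<dots> = hnorm H f * hnorm E (f 0)"
        using f by (simp add: norm_K_0 val)
      finally have "hnorm E (f 0) \<le> hnorm H f"
        using f E.hnorm_nonneg[OF val[OF f zero]]
        by (cases "hnorm E (f 0) = 0") (auto simp: power2_eq_square)
      also have "\<dots> \<le> hnorm H (K 0 \<eta>)"
        using contraction \<eta> by (simp add: contraction_op_def f_def K)
      finally show ?thesis
        using \<eta> by (simp add: f_0 norm_K_0)
    qed
    moreover have "(\<lambda>m. hnorm E ((A 0 ^^ m) \<eta>)) \<longlonglongrightarrow> 0" if \<eta>: "\<eta> \<in> hcarrier E" for \<eta>
    proof -
      have "(\<lambda>m. hnorm H ((S ^^ m) (K 0 \<eta>))) \<longlonglongrightarrow> 0"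
        using pure \<eta> by (simp add: pure_contraction_def S_def K)
      then show ?thesis
        using \<eta> by (simp add: S_funpow norm_K_0 A_funpow)
    qed
    ultimately show "pure_contraction E (\<Phi> 0)"
      by (simp add: pure_contraction_def contraction_op_def bounded A_def)
  next
    assume pure: "pure_contraction E (\<Phi> 0)"
    have stable_0: "(\<lambda>m. hnorm H ((S ^^ m) (K 0 \<eta>))) \<longlonglongrightarrow> 0" if \<eta>: "\<eta> \<in> hcarrier E" for \<eta>
      using pure \<eta> by (simp add: S_funpow norm_K_0 A_funpow pure_contraction_def flip: A_def)
    have S_carrier: "(S ^^ m) f \<in> hcarrier H"
      and S_norm: "hnorm H ((S ^^ m) f) \<le> hnorm H f"
      if "f \<in> hcarrier H" for m f
      using H.contraction_op_funpow[OF contraction_S, of m] that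
      by (auto simp: contraction_op_def bounded_operator_def)
    have S_add: "(S ^^ m) (f + g) = (S ^^ m) f + (S ^^ m) g"
      if "f \<in> hcarrier H" "g \<in> hcarrier H" for m f g
      using H.contraction_op_funpow[OF contraction_S, of m] that
      by (auto simp: contraction_op_def bounded_operator_def)
    have stable: "(\<lambda>m. hnorm H ((S ^^ m) (K w \<eta>))) \<longlonglongrightarrow> 0"
      if w: "w \<in> polydisc" and \<eta>: "\<eta> \<in> hcarrier E" for w \<eta>
    proof -
      define t where "t m = hnorm H ((S ^^ m) (K w \<eta>))" for m
      have t_nonneg: "0 \<le> t m" for m
        using w \<eta> by (simp add: t_def S_carrier K)
      have "decseq t"
        unfolding decseq_Suc_iff t_def
        using contraction_S S_carrier K[OF w \<eta>] by (simp add: contraction_op_def)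
      then obtain L where L: "t \<longlonglongrightarrow> L"
        using decseq_convergent t_nonneg by blast
      have L_nonneg: "0 \<le> L"
        using L t_nonneg by (intro LIMSEQ_le_const) auto
      define a where "a j = hnorm E ((A w ^^ j) \<eta>)" for j
      have t_a: "(t j)\<^sup>2 = Re (k w w) * (a j)\<^sup>2" for j
        using w \<eta> by (simp add: t_def a_def S_funpow norm_K A_funpow)
      \<comment> \<open>By \<open>t_a\<close> the right-hand side is
        \<open>(Re (k w w) - 1) * (a j)^2\<close>, the squared norm of the non-constant
        part.\<close>
      have L_le: "L\<^sup>2 \<le> (t j)\<^sup>2 - (a j)\<^sup>2" for j
      proof -
        define \<xi> where "\<xi> = (A w ^^ j) \<eta>"
        have \<xi>: "\<xi> \<in> hcarrier E"
          using w \<eta> by (simp add: \<xi>_def A_funpow)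
        have bound: "t (m + j) \<le> hnorm H ((S ^^ m) (K 0 \<xi>)) + hnorm H (K w \<xi> - K 0 \<xi>)" for m
        proof -
          have "t (m + j) = hnorm H ((S ^^ m) (K 0 \<xi>) + (S ^^ m) (K w \<xi> - K 0 \<xi>))"
            using S_add[of "K 0 \<xi>" "K w \<xi> - K 0 \<xi>" m] w \<eta> \<xi>
            by (simp add: t_def funpow_add S_funpow[of _ _ j] K flip: \<xi>_def)
          also have "\<dots> \<le> hnorm H ((S ^^ m) (K 0 \<xi>)) + hnorm H ((S ^^ m) (K w \<xi> - K 0 \<xi>))"
            using w \<xi> by (simp add: H.hnorm_triangle S_carrier K)
          also have "hnorm H ((S ^^ m) (K w \<xi> - K 0 \<xi>)) \<le> hnorm H (K w \<xi> - K 0 \<xi>)"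
            using w \<xi> by (simp add: S_norm K)
          finally show ?thesis
            by simp
        qed
        \<comment> \<open>Here \<open>m\<close> tends to infinity with \<open>j\<close> fixed: the
          orbit of \<open>K 0 \<xi>\<close> dies out, and the other term does not depend on
          \<open>m\<close>.\<close>
        have "L \<le> 0 + hnorm H (K w \<xi> - K 0 \<xi>)"
          by (rule LIMSEQ_le[OF LIMSEQ_ignore_initial_segment[OF L, of j]
                tendsto_add[OF stable_0[OF \<xi>] tendsto_const]]) (use bound in blast)
        then have "L\<^sup>2 \<le> (hnorm H (K w \<xi> - K 0 \<xi>))\<^sup>2"
          using L_nonneg by (simp add: power_mono)
        also have "\<dots> = (t j)\<^sup>2 - (a j)\<^sup>2"
          using w \<xi> by (simp add: norm_K_diff t_a a_def \<xi>_def algebra_simps)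
        finally show ?thesis .
      qed
      have "L\<^sup>2 \<le> 0"
      proof (cases "Re (k w w) > 0")
        case True
        have lim: "(\<lambda>j. (t j)\<^sup>2) \<longlonglongrightarrow> L\<^sup>2"
          by (intro tendsto_intros L)
        \<comment> \<open>Now \<open>j\<close> tends to infinity, with \<open>(a j)^2\<close>
          rewritten as \<open>(t j)^2 / Re (k w w)\<close> so that its limit is known.\<close>
        then have "(\<lambda>j. (t j)\<^sup>2 - (t j)\<^sup>2 / Re (k w w)) \<longlonglongrightarrow> L\<^sup>2 - L\<^sup>2 / Re (k w w)"
          using True by (intro tendsto_diff tendsto_divide tendsto_const) auto
        moreover have "L\<^sup>2 \<le> (t j)\<^sup>2 - (t j)\<^sup>2 / Re (k w w)" for j
          using L_le[of j] True by (simp add: t_a)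
        ultimately have "L\<^sup>2 \<le> L\<^sup>2 - L\<^sup>2 / Re (k w w)"
          by (intro LIMSEQ_le_const) auto
        then show ?thesis
          using True by (simp add: divide_le_0_iff)
      next
        \<comment> \<open>The diagonal need not be positive: \<open>dirichlet_kernel w w\<close>,
          whose logarithm carries no minus sign, is negative when an odd number of coordinates of
          \<open>w\<close> are nonzero. Then \<open>(t 0)^2\<close> is at most 0, and
          \<open>L_le\<close> at \<open>j = 0\<close> suffices.\<close>
        case False
        then have "Re (k w w) * (a 0)\<^sup>2 \<le> 0"
          by (simp add: mult_nonpos_nonneg)
        then show ?thesis
          using L_le[of 0] zero_le_power2[of "a 0"] unfolding t_a by linarith
      qed
      then show ?thesis
        using L by (simp add: t_def[abs_def])
    qed
    have "(\<lambda>m. hnorm H ((S ^^ m) h)) \<longlonglongrightarrow> 0" if h: "h \<in> hcarrier H" for h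
    proof (rule H.strongly_stable_if_total[OF contraction_S])
      let ?D = "{K w \<eta> |w \<eta>. w \<in> polydisc \<and> \<eta> \<in> hcarrier E}"
      fix f
      assume f: "f \<in> hcarrier H" and orth: "\<And>y. y \<in> ?D \<Longrightarrow> hinner H y f = 0"
      have "f w = 0" if w: "w \<in> polydisc" for w
      proof (rule E.hinner_definite)
        \<comment> \<open>Choosing the coefficient vector \<open>f w\<close> turns orthogonality
          into vanishing of the norm of \<open>f w\<close>. Outside the polydisc \<open>f\<close> is
          zero by the convention of \<open>rkhs\<close>.\<close>
        have "hinner H (K w (f w)) f = 0"
          using w f val by (intro orth) blast
        then have "hinner H f (K w (f w)) = 0"
          using H.hinner_commute[of f "K w (f w)"] f w by (simp add: K val)
        then show "hinner E (f w) (f w) = 0"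
          using f w by (simp add: reproducing val)
      qed (use f w val in blast)
      then show "f = 0"
        using outside[OF f] by (auto simp: fun_eq_iff)
    qed (use h in \<open>auto simp: K stable\<close>)
    with contraction show "pure_contraction H (mult_op \<Phi>)"
      by (simp add: pure_contraction_def S_def)
  qed
qed

theorem theorem1p7:
  fixes E :: "'e::ab_group_add hspace"
    and k :: "complex ^ 'n \<Rightarrow> complex ^ 'n \<Rightarrow> complex"
    and H :: "(complex ^ 'n \<Rightarrow> 'e) hspace"
    and \<Phi> :: "complex ^ 'n \<Rightarrow> 'e \<Rightarrow> 'e"
  assumes "complex_hilbert_space E"
    and "k = hardy_kernel \<or> k = bergman_kernel \<or> k = dirichlet_kernel"
    and "rkhs k E H"
    and "\<Phi> \<in> Mult E H"
    and "contraction_op H (mult_op \<Phi>)"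
  shows "pure_contraction H (mult_op \<Phi>) \<longleftrightarrow> pure_contraction E (\<Phi> 0)"
proof (rule pure_contraction_mult_op_iff[OF assms(1) _ assms(3-5)])
  \<comment> \<open>At \<open>z = 0\<close> every factor is 1; for \<open>dirichlet_kernel\<close>
    this is the first branch of the conditional.\<close>
  show "k 0 w = 1" for w
    using assms(2) by (auto simp: hardy_kernel_def bergman_kernel_def dirichlet_kernel_def)
qed

end
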